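(* Let $G$ be a finite simple undirected graph that contains no induced subgraph isomorphic to $P_4 \cup K_1$ and no induced subgraph isomorphic to the Kite. Then $\chi(G) \leq \left\lceil \frac{\Delta(G) + \omega(G) + 1}{2} \right\rceil$.
   Context: $\chi(G)$, $\Delta(G)$, $\omega(G)$ denote the chromatic number, maximum degree and clique number of $G$. $P_4 \cup K_1$ is the disjoint union of a path on four vertices and an isolated vertex. The Kite is the 5-vertex graph obtained from the diamond $K_4 - e$ (the complete graph on four vertices minus one edge) by adding a new vertex adjacent to exactly one of the two degree-2 vertices of the diamond; equivalently, it is the complement of the Chair. The Chair (also called fork) is the 5-vertex graph obtained from the star $K_{1,3}$ by subdividing one edge once. "Contains no induced subgraph isomorphic to $F$" means no subset of vertices of $G$ induces a graph isomorphic to $F$. *)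

theory Defs
  imports Complex_Main "Graph_Theory.Graph_Theory"
begin

text \<open>
  Finite simple undirected graphs are the finite, loop-free, symmetric digraphs without
  parallel arcs (locale \<^term>\<open>graph\<close>): an edge \<open>uv\<close> is the pair of arcs \<open>u \<rightarrow> v\<close>, \<open>v \<rightarrow> u\<close>.
  Hence the degree of a vertex is its out-degree. The graph without vertices is allowed and
  has maximum degree 0.
\<close>

definition max_degree :: "('a,'b) pre_digraph \<Rightarrow> nat" where
  "max_degree G = Max (insert 0 (out_degree G ` verts G))"

definition clique :: "('a,'b) pre_digraph \<Rightarrow> 'a set \<Rightarrow> bool" where
  "clique G S \<longleftrightarrow> S \<subseteq> verts G \<and> (\<forall>u\<in>S. \<forall>v\<in>S. u \<noteq> v \<longrightarrow> u \<rightarrow>\<^bsub>G\<^esub> v)"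

definition clique_number :: "('a,'b) pre_digraph \<Rightarrow> nat" where
  "clique_number G = Max {card S | S. clique G S}"

definition proper_coloring :: "('a,'b) pre_digraph \<Rightarrow> nat \<Rightarrow> ('a \<Rightarrow> nat) \<Rightarrow> bool" where
  "proper_coloring G k c \<longleftrightarrow>
     c ` verts G \<subseteq> {..<k} \<and> (\<forall>u v. u \<rightarrow>\<^bsub>G\<^esub> v \<longrightarrow> c u \<noteq> c v)"

definition chromatic_number :: "('a,'b) pre_digraph \<Rightarrow> nat" where
  "chromatic_number G = (LEAST k. \<exists>c. proper_coloring G k c)"

definition contains_induced :: "('a,'b) pre_digraph \<Rightarrow> ('c,'d) pre_digraph \<Rightarrow> bool" where
  "contains_induced G F \<longleftrightarrow> (\<exists>S \<subseteq> verts G. digraph_iso (G \<restriction> S) F)"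

definition P4_K1 :: "(nat, nat \<times> nat) pre_digraph" where
  "P4_K1 = with_proj \<lparr> pverts = {0, 1, 2, 3, 4}, parcs = symcl {(0,1), (1,2), (2,3)} \<rparr>"

text \<open>
  The vertices 0, 1, 2, 3 induce the diamond, with 0 and 3 of degree 2; the vertex 4 is
  attached to 3.
\<close>

definition kite :: "(nat, nat \<times> nat) pre_digraph" where
  "kite = with_proj \<lparr> pverts = {0, 1, 2, 3, 4},
     parcs = symcl {(0,1), (0,2), (1,2), (1,3), (2,3), (3,4)} \<rparr>"

end

theory Submission
  imports Defs
begin

text \<open>
  Colourings of \<open>G\<close> are covers of its complement \<open>H\<close> by cliques, and \<open>H\<close> is chair-free and
  gem-free. In a minimal counterexample no edge \<open>ux\<close> of \<open>H\<close> satisfies \<open>N[u] \<subseteq> N[x]\<close> (delete \<open>x\<close>),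
  and no maximal clique \<open>Q\<close> of \<open>H\<close> meets all maximum independent sets (delete \<open>Q\<close>: both
  \<open>\<Delta>(G)\<close> and \<open>\<omega>(G)\<close> drop). So every vertex \<open>v\<close> lies in a maximal clique \<open>Q\<close> that misses some maximum
  independent set \<open>I\<close>. Exchange arguments along \<open>I\<close> then show that \<open>v\<close> has a unique neighbour in
  \<open>I\<close> and that the neighbourhood of \<open>v\<close> is the disjoint union of two cliques without edges between
  them, i.e. \<open>H\<close> is the line graph of a triangle-free graph.

  Let \<open>v\<close> be a vertex of minimum degree \<open>|A| + |B|\<close> with cliques \<open>|A| \<le> |B|\<close>. If \<open>|B| \<ge> 2\<close>, the
  cliques other than \<open>A \<union> {v}\<close> at the vertices of \<open>A \<union> {v}\<close> are disjoint, have size at least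
  \<open>|B| + 1\<close>, and save enough over a covering by a maximal matching and its unmatched vertices.
  If \<open>|A| = |B| = 1\<close>, two disjoint edges covering \<open>N[v]\<close> suffice instead, since they lower the
  independence number of the rest.
\<close>

subsection \<open>Clique covers\<close>

definition cliq :: "('a \<Rightarrow> 'a \<Rightarrow> bool) \<Rightarrow> 'a set \<Rightarrow> bool" where
  "cliq E Q \<longleftrightarrow> (\<forall>x\<in>Q. \<forall>y\<in>Q. x \<noteq> y \<longrightarrow> E x y)"

definition indep :: "('a \<Rightarrow> 'a \<Rightarrow> bool) \<Rightarrow> 'a set \<Rightarrow> bool" where
  "indep E I \<longleftrightarrow> (\<forall>x\<in>I. \<forall>y\<in>I. \<not> E x y)"

definition clique_cover :: "'a set \<Rightarrow> ('a \<Rightarrow> 'a \<Rightarrow> bool) \<Rightarrow> nat \<Rightarrow> bool" where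
  "clique_cover V E k \<longleftrightarrow>
     (\<exists>c. c ` V \<subseteq> {..<k} \<and> (\<forall>x\<in>V. \<forall>y\<in>V. x \<noteq> y \<longrightarrow> c x = c y \<longrightarrow> E x y))"

lemma cliqD: "cliq E Q \<Longrightarrow> x \<in> Q \<Longrightarrow> y \<in> Q \<Longrightarrow> x \<noteq> y \<Longrightarrow> E x y"
  by (simp add: cliq_def)

lemma clique_cover_mono:
  assumes "clique_cover V E k" "k \<le> l"
  shows "clique_cover V E l"
  using assms unfolding clique_cover_def by (metis lessThan_subset_iff subset_trans)

lemma clique_cover_empty [simp]: "clique_cover {} E k"
  by (simp add: clique_cover_def)

lemma clique_cover_Un_cliq:
  assumes "clique_cover V E k" "cliq E Q"
  shows "clique_cover (V \<union> Q) E (Suc k)"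
proof -
  obtain c where c: "c ` V \<subseteq> {..<k}" "\<forall>x\<in>V. \<forall>y\<in>V. x \<noteq> y \<longrightarrow> c x = c y \<longrightarrow> E x y"
    using assms(1) unfolding clique_cover_def by blast
  define d where "d x = (if x \<in> Q then k else c x)" for x
  have "d ` (V \<union> Q) \<subseteq> {..<Suc k}"
    using c(1) by (force simp: d_def)
  moreover have "E x y" if "x \<in> V \<union> Q" "y \<in> V \<union> Q" "x \<noteq> y" "d x = d y" for x y
  proof (cases "x \<in> Q \<or> y \<in> Q")
    case True
    then have "x \<in> Q \<and> y \<in> Q"
      using that c(1) by (auto simp: d_def split: if_splits)
    then show ?thesis
      using assms(2) that(3) by (auto simp: cliq_def)
  next
    case False
    then show ?thesis
      using that c(2) by (auto simp: d_def)
  qed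
  ultimately show ?thesis
    unfolding clique_cover_def by blast
qed

lemma clique_cover_UN_cliq:
  assumes "finite A" "clique_cover V E k" "\<And>a. a \<in> A \<Longrightarrow> cliq E (Q a)"
  shows "clique_cover (V \<union> (\<Union>a\<in>A. Q a)) E (k + card A)"
  using assms
proof (induction A rule: finite_induct)
  case (insert a A)
  then have "clique_cover ((V \<union> (\<Union>a\<in>A. Q a)) \<union> Q a) E (Suc (k + card A))"
    by (intro clique_cover_Un_cliq) auto
  moreover have "(V \<union> (\<Union>a\<in>A. Q a)) \<union> Q a = V \<union> (\<Union>a\<in>insert a A. Q a)"
    by blast
  ultimately show ?case
    using insert.hyps by simp
qed simp

text \<open>Peel off edges until none is left. The r remaining vertices are independent, so r is at
  most \<open>w\<close>; with r singletons the number of cliques is (|R| - r) / 2 + r = (|R| + r) /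
  2.\<close>

lemma clique_cover_greedy_matching:
  assumes "finite R" "symp E" "irreflp E" "\<And>I. I \<subseteq> R \<Longrightarrow> indep E I \<Longrightarrow> card I \<le> w"
  shows "\<exists>m. 2 * m \<le> card R + w \<and> clique_cover R E m"
  using assms
proof (induction "card R" arbitrary: R rule: less_induct)
  case less
  show ?case
  proof (cases "\<exists>x\<in>R. \<exists>y\<in>R. x \<noteq> y \<and> E x y")
    case True
    then obtain x y where xy: "x \<in> R" "y \<in> R" "x \<noteq> y" "E x y"
      by blast
    let ?S = "R - {x, y}"
    have c: "card R = card ?S + 2"
      using xy less.prems(1) card_mono[of R "{x, y}"] by (subst card_Diff_subset) auto
    have "\<exists>m. 2 * m \<le> card ?S + w \<and> clique_cover ?S E m"
      by (rule less.hyps) (use c less.prems in auto)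
    then obtain m where m: "2 * m \<le> card ?S + w" "clique_cover ?S E m"
      by blast
    have "cliq E {x, y}"
      using xy less.prems(2) by (auto simp: cliq_def symp_def)
    moreover have "?S \<union> {x, y} = R"
      using xy by blast
    ultimately have "clique_cover R E (Suc m)"
      using clique_cover_Un_cliq[OF m(2)] by metis
    then show ?thesis
      using m c by (intro exI[of _ "Suc m"]) simp
  next
    case False
    obtain c where c: "bij_betw c R {..<card R}"
      using less.prems(1) by (metis atLeast0LessThan ex_bij_betw_finite_nat)
    then have "clique_cover R E (card R)"
      unfolding clique_cover_def by (intro exI[of _ c]) (auto simp: bij_betw_def inj_on_def)
    moreover have "card R \<le> w"
      using False less.prems(3) unfolding irreflp_def
      by (intro less.prems(4)) (force simp: indep_def)+
    ultimately show ?thesis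
      by (intro exI[of _ "card R"]) simp
  qed
qed


subsection \<open>Neighbourhoods in chair-free and gem-free graphs\<close>

locale fin_graph =
  fixes V :: "'a set" and E :: "'a \<Rightarrow> 'a \<Rightarrow> bool"
  assumes finite_V: "finite V"
    and E_in_V: "E x y \<Longrightarrow> x \<in> V"
    and E_sym: "E x y \<Longrightarrow> E y x"
    and E_irrefl: "\<not> E x x"
begin

definition maximal_cliq :: "'a set \<Rightarrow> bool" where
  "maximal_cliq Q \<longleftrightarrow> Q \<subseteq> V \<and> cliq E Q \<and> (\<forall>z\<in>V - Q. \<exists>q\<in>Q. \<not> E q z)"

definition max_indep :: "'a set \<Rightarrow> bool" where
  "max_indep I \<longleftrightarrow> I \<subseteq> V \<and> indep E I \<and> (\<forall>J\<subseteq>V. indep E J \<longrightarrow> card J \<le> card I)"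

lemma ex_maximal_cliq:
  assumes "cliq E C" "C \<subseteq> V"
  obtains Q where "maximal_cliq Q" "C \<subseteq> Q"
proof -
  let ?F = "{Q. Q \<subseteq> V \<and> cliq E Q}"
  have "finite ?F"
    using finite_V by simp
  then obtain Q where Q: "Q \<in> ?F" "C \<subseteq> Q" "\<forall>P\<in>?F. Q \<subseteq> P \<longrightarrow> Q = P"
    using finite_has_maximal2[of ?F C] assms by blast
  have "\<exists>q\<in>Q. \<not> E q z" if "z \<in> V - Q" for z
  proof (rule ccontr)
    assume "\<not> (\<exists>q\<in>Q. \<not> E q z)"
    then have "insert z Q \<in> ?F"
      using that Q(1) E_sym by (auto simp: cliq_def)
    then show False
      using Q(3) that by blast
  qed
  then show thesis
    using that[of Q] Q unfolding maximal_cliq_def by blast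
qed

text \<open>\<open>(I - R) \<union> X\<close> is again independent, since every vertex of
  \<open>I\<close> adjacent to \<open>X\<close> is removed with \<open>R\<close>; it cannot be
  larger than \<open>I\<close>.\<close>

lemma max_indep_exchange:
  assumes "max_indep I" "X \<subseteq> V - I" "indep E X" "R \<subseteq> I"
    and nbrs: "\<And>x i. x \<in> X \<Longrightarrow> i \<in> I \<Longrightarrow> E x i \<Longrightarrow> i \<in> R"
  shows "card X \<le> card R"
proof -
  let ?J = "(I - R) \<union> X"
  have fin: "finite I" "finite R" "finite X"
    using assms finite_V unfolding max_indep_def by (meson Diff_subset finite_subset)+
  have "indep E ?J"
  proof -
    have "\<not> E x y" if "x \<in> I" "y \<in> I" for x y
      using assms(1) that by (auto simp: max_indep_def indep_def)
    moreover have "\<not> E x y" if "x \<in> X" "y \<in> X" for x y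
      using assms(3) that by (auto simp: indep_def)
    moreover have "\<not> E x y" "\<not> E y x" if "x \<in> X" "y \<in> I - R" for x y
      using nbrs[of x y] E_sym[of y x] that by auto
    ultimately show ?thesis
      unfolding indep_def by blast
  qed
  moreover have "?J \<subseteq> V"
    using assms by (auto simp: max_indep_def)
  ultimately have "card ?J \<le> card I"
    using assms(1) by (auto simp: max_indep_def)
  moreover have "card ?J = (card I - card R) + card X"
    using assms fin by (subst card_Un_disjoint) (auto simp: card_Diff_subset)
  moreover have "card R \<le> card I"
    using assms(4) fin by (simp add: card_mono)
  ultimately show ?thesis
    by linarith
qed

lemma max_indep_nbr:
  assumes "max_indep I" "v \<in> V - I"
  obtains i where "i \<in> I" "E v i"
proof (rule ccontr)
  assume "\<not> thesis"
  then have "card {v} \<le> card ({} :: 'a set)"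
    using assms that E_irrefl by (intro max_indep_exchange[OF assms(1)]) (auto simp: indep_def)
  then show False
    by simp
qed

end

text \<open>Each implication concludes with the edge that destroys the forbidden pattern. In
  \<open>chair_free\<close>, \<open>c\<close> is the centre, \<open>x\<close> and \<open>y\<close>
  are leaves and c z p is the long leg; in \<open>gem_free\<close>, \<open>c\<close> dominates the
  path p q r s. Without \<open>x \<noteq> y\<close>, the chair would collapse to an induced path on
  four vertices.\<close>

locale chair_gem_free = fin_graph +
  assumes chair_free: "\<lbrakk>x \<noteq> y; E c x; E c y; E c z; E z p;
      \<not> E x y; \<not> E x z; \<not> E y z; \<not> E c p; \<not> E x p\<rbrakk> \<Longrightarrow> E y p"
    and gem_free: "\<lbrakk>E c p; E c q; E c r; E c s; E p q; E q r; E r s;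
      \<not> E p r; \<not> E q s\<rbrakk> \<Longrightarrow> E p s"
begin

text \<open>The condition that drives the exchange arguments for maximum \<open>I\<close>: it makes
  the neighbour i of \<open>v\<close> in \<open>I\<close> unique, and it passes on to the neighbours
  of \<open>v\<close> other than i that are not adjacent to i.\<close>

definition missed :: "'a set \<Rightarrow> 'a \<Rightarrow> bool" where
  "missed I v \<longleftrightarrow> (\<exists>Q. maximal_cliq Q \<and> v \<in> Q \<and> Q \<inter> I = {})"

text \<open>
  Gem-freeness makes the traces of \<open>I\<close>-vertices on the missed clique laminar; a second neighbour in
  \<open>I\<close> then yields a chair.
\<close>

lemma missed_nbr_unique:
  assumes I: "max_indep I" and "missed I q" and il: "i \<in> I" "l \<in> I" "E q i" "E q l"
  shows "i = l"
proof (rule ccontr)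
  assume "i \<noteq> l"
  obtain Q where Q: "maximal_cliq Q" "q \<in> Q" "Q \<inter> I = {}"
    using assms(2) by (auto simp: missed_def)
  define tr where "tr j = {p \<in> Q. E p j}" for j
  have QV: "Q \<subseteq> V" and Qc: "\<And>x y. x \<in> Q \<Longrightarrow> y \<in> Q \<Longrightarrow> x \<noteq> y \<Longrightarrow> E x y"
    using Q(1) by (auto simp: maximal_cliq_def cliq_def)
  have Ind: "\<not> E x y" if "x \<in> I" "y \<in> I" for x y
    using that I by (auto simp: max_indep_def indep_def)
  have IV: "I \<subseteq> V"
    using I by (auto simp: max_indep_def)
  have laminar: "tr a \<subseteq> tr b \<or> tr b \<subseteq> tr a" if ab: "a \<in> I" "b \<in> I" "E q a" "E q b" for a b
  proof (rule ccontr)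
    assume "\<not> ?thesis"
    then obtain x y where x: "x \<in> Q" "E x a" "\<not> E x b" and y: "y \<in> Q" "E y b" "\<not> E y a"
      by (auto simp: tr_def)
    then have "E q x" "E q y" "E x y"
      using ab Qc[of q x] Qc[of q y] Qc[of x y] Q(2) by auto
    then show False
      using gem_free[of q a x y b] ab x y Ind[of a b] E_sym by blast
  qed
  have "finite {tr a |a. a \<in> I \<and> E q a}" "{tr a |a. a \<in> I \<and> E q a} \<noteq> {}"
    using il finite_subset[OF IV finite_V] by auto
  \<comment> \<open>By laminarity an inclusion-maximal trace contains the traces of all
    \<open>I\<close>-neighbours of \<open>q\<close>. As \<open>Q\<close> is maximal, some
    \<open>q'\<close> in \<open>Q\<close> lies outside it, so \<open>q'\<close> shares no
    \<open>I\<close>-neighbour with \<open>q\<close>.\<close>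
  from finite_has_maximal[OF this] obtain a where a: "a \<in> I" "E q a"
    and amax: "\<And>b. b \<in> I \<Longrightarrow> E q b \<Longrightarrow> tr a \<subseteq> tr b \<Longrightarrow> tr a = tr b"
    by blast
  obtain b where b: "b \<in> I" "E q b" "b \<noteq> a"
    using il \<open>i \<noteq> l\<close> by metis
  have sub: "tr c \<subseteq> tr a" if "c \<in> I" "E q c" for c
    using laminar[OF that(1) a(1) that(2) a(2)] amax[OF that] by blast
  obtain q' where q': "q' \<in> Q" "\<not> E q' a"
    using a(1) Q IV unfolding maximal_cliq_def by blast
  then have "\<not> E q' b"
    using sub[OF b(1,2)] by (auto simp: tr_def)
  obtain j where j: "j \<in> I" "E q' j"
    using max_indep_nbr[OF I, of q'] q'(1) QV Q(3) by blast
  have "\<not> E q j"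
    using sub[OF j(1)] j(2) q' by (auto simp: tr_def)
  moreover have "E q q'"
    using Qc[OF Q(2) q'(1)] a(2) q'(2) by auto
  \<comment> \<open>Chair with centre \<open>q\<close>, leaves \<open>a\<close>, \<open>b\<close>
    and long leg q q' j.\<close>
  ultimately show False
    using chair_free[of a b q q' j] a b j q' \<open>\<not> E q' b\<close> Ind E_sym by blast
qed

section \<open>The neighbours of a missed vertex, far from or near to its
  \<open>I\<close>-neighbour\<close>

context
  fixes I v i
  assumes I: "max_indep I" and v: "missed I v" and i: "i \<in> I" "E v i"
begin

lemma I_not_adj: "x \<in> I \<Longrightarrow> y \<in> I \<Longrightarrow> \<not> E x y"
  using I by (auto simp: max_indep_def indep_def)

lemma missed_notin: "v \<notin> I"
  using v by (auto simp: missed_def)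

lemma nbr_in_I: "E v x \<Longrightarrow> x \<in> I \<Longrightarrow> x = i"
  using missed_nbr_unique[OF I v] i by blast

text \<open>A maximal clique through \<open>v\<close> and \<open>x\<close> can meet \<open>I\<close>
  only in \<open>i\<close>, the sole \<open>I\<close>-neighbour of \<open>v\<close>, and
  \<open>x\<close> excludes \<open>i\<close>.\<close>

lemma missed_nbr:
  assumes "E v x" "\<not> E x i" "x \<noteq> i"
  shows "missed I x"
proof -
  have "cliq E {v, x}" "{v, x} \<subseteq> V"
    using assms(1) E_sym E_in_V by (auto simp: cliq_def)
  then obtain Q where Q: "maximal_cliq Q" "{v, x} \<subseteq> Q"
    by (rule ex_maximal_cliq)
  have "z \<notin> I" if "z \<in> Q" for z
  proof
    assume "z \<in> I"
    then have "z \<noteq> v"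
      using missed_notin by blast
    then have "z = i"
      using Q that \<open>z \<in> I\<close> by (intro nbr_in_I) (auto simp: maximal_cliq_def cliq_def)
    then show False
      using Q that assms by (auto simp: maximal_cliq_def cliq_def)
  qed
  then show ?thesis
    using Q by (auto simp: missed_def)
qed

lemma ex_missed_nbr:
  obtains y where "E v y" "\<not> E y i" "y \<noteq> i"
proof -
  obtain Q where Q: "maximal_cliq Q" "v \<in> Q" "Q \<inter> I = {}"
    using v by (auto simp: missed_def)
  then obtain q where "q \<in> Q" "\<not> E q i"
    using i I unfolding maximal_cliq_def max_indep_def by blast
  moreover have "E v q"
    using Q \<open>q \<in> Q\<close> \<open>\<not> E q i\<close> i by (auto simp: maximal_cliq_def cliq_def)
  ultimately show thesis
    using that Q i by blast
qed

text \<open>Both vertices are missed, hence have one \<open>I\<close>-neighbour each. If they were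
  not adjacent, the chair at \<open>v\<close> with leaves \<open>i\<close>, \<open>y\<close> and
  long leg v x j would make \<open>j\<close> common to both, and swapping \<open>j\<close> for
  \<open>{x, y}\<close> would enlarge \<open>I\<close>.\<close>

lemma far_nbrs_adj:
  assumes x: "E v x" "\<not> E x i" "x \<noteq> i" and y: "E v y" "\<not> E y i" "y \<noteq> i" and "x \<noteq> y"
  shows "E x y"
proof (rule ccontr)
  assume nE: "\<not> E x y"
  note mx = missed_nbr[OF x] and my = missed_nbr[OF y]
  have xI: "x \<in> V - I" "y \<in> V - I"
    using mx my by (auto simp: missed_def maximal_cliq_def)
  obtain j where j: "j \<in> I" "E x j"
    using max_indep_nbr[OF I xI(1)] .
  have "\<not> E v j"
    using nbr_in_I[of j] j x by blast
  then have "E y j"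
    using chair_free[of i y v x j] i x y j nE E_sym I_not_adj[OF i(1) j(1)] by blast
  have "card {x, y} \<le> card {j}"
  proof (rule max_indep_exchange[OF I])
    show "indep E {x, y}"
      using nE E_irrefl E_sym unfolding indep_def by blast
  qed (use xI j \<open>E y j\<close> missed_nbr_unique[OF I mx] missed_nbr_unique[OF I my] in blast)+
  then show False
    using \<open>x \<noteq> y\<close> by simp
qed

end

text \<open>Otherwise take a far neighbour \<open>y\<close> of \<open>v\<close> and its
  \<open>I\<close>-neighbour \<open>j\<close>. First \<open>w\<close> and \<open>w'\<close> are
  shown not adjacent to \<open>y\<close>, then one of them is adjacent to \<open>j\<close>, and
  finally all \<open>I\<close>-neighbours of \<open>w\<close>, \<open>w'\<close>, \<open>y\<close>
  lie in \<open>{i, j}\<close>, so an exchange of two vertices for three contradicts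
  maximality.\<close>

lemma near_nbrs_adj:
  assumes I: "max_indep I" and v: "missed I v" and i: "i \<in> I" "E v i"
    and w: "E v w" "E w i" and w': "E v w'" "E w' i" and "w \<noteq> w'"
  shows "E w w'"
proof (rule ccontr)
  assume nE: "\<not> E w w'"
  note Iv = I v i
  obtain y where y: "E v y" "\<not> E y i" "y \<noteq> i"
    using ex_missed_nbr[OF Iv] .
  have my: "missed I y"
    using missed_nbr[OF Iv y] .
  have notI: "y \<notin> I" "w \<notin> I" "w' \<notin> I"
    using nbr_in_I[OF Iv] y w w' E_irrefl by blast+
  have inV: "y \<in> V" "w \<in> V" "w' \<in> V"
    using y w w' E_in_V E_sym by blast+
  obtain j where j: "j \<in> I" "E y j"
    using max_indep_nbr[OF I, of y] inV notI by blast
  have fy: "l = j" if "l \<in> I" "E y l" for l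
    using missed_nbr_unique[OF I my that(1) j(1) that(2) j(2)] .
  have "i \<noteq> j" "\<not> E v j"
    using j y nbr_in_I[OF Iv, of j] by auto
  have ij: "\<not> E i j"
    using I_not_adj[OF Iv i(1) j(1)] .
  \<comment> \<open>Otherwise \<open>u\<close> dominates the path i v y j, a gem.\<close>
  have nj: "\<not> E u j" if "E v u" "E u i" "E u y" for u
    using gem_free[of u i v y j] that i y j ij \<open>\<not> E v j\<close> E_sym by blast
  have ww'_y: "\<not> E w y" "\<not> E w' y"
  proof -
    \<comment> \<open>If both were adjacent to \<open>y\<close>, then by \<open>nj\<close> they
      would be far neighbours of \<open>y\<close> with respect to \<open>j\<close>, hence adjacent.
      If only one were, \<open>v\<close> would be the centre of a gem.\<close>
    have "\<not> (E w y \<and> E w' y)"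
      using far_nbrs_adj[OF I my j(1) j(2), of w w'] nj[of w] nj[of w'] w w' notI j(1)
        \<open>w \<noteq> w'\<close> nE E_sym by blast
    moreover have "\<not> (E u y \<and> \<not> E u' y)"
      if "E v u" "E u i" "E v u'" "E u' i" "\<not> E u u'" for u u'
      using gem_free[of v y u i u'] that y i E_sym by blast
    ultimately show "\<not> E w y" "\<not> E w' y"
      using w w' nE E_sym by blast+
  qed
  txt \<open>Here \<open>I - {i, j} \<union> {u, u', y}\<close> is independent and larger than \<open>I\<close>.\<close>
  have larger: False if u: "E v u" "E u i" "\<not> E u y" "u \<in> V - I"
    and u': "E v u'" "E u' i" "\<not> E u' y" "u' \<in> V - I" and uu': "u \<noteq> u'" "\<not> E u u'" and uj: "E u j"
    for u u'
  proof -
    \<comment> \<open>Chair with centre \<open>u\<close>, leaves \<open>i\<close>, \<open>l\<close>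
      and long leg u j y.\<close>
    have Nu: "l \<in> {i, j}" if l: "l \<in> I" "E u l" for l
    proof (rule ccontr)
      assume "l \<notin> {i, j}"
      then show False
        using chair_free[of i l u j y] u uj l y j fy[of l] ij i I_not_adj[OF Iv] E_sym by blast
    qed
    \<comment> \<open>Chair with centre \<open>v\<close>, leaves \<open>y\<close>, \<open>u\<close>
      and long leg v u' l.\<close>
    have Nu': "l \<in> {i, j}" if l: "l \<in> I" "E u' l" for l
    proof (rule ccontr)
      assume n: "l \<notin> {i, j}"
      then have "\<not> E u l" "\<not> E v l" "\<not> E y l"
        using Nu[OF l(1)] nbr_in_I[OF Iv, of l] l(1) fy by blast+
      moreover have "y \<noteq> u"
        using u y by blast
      ultimately show False
        using chair_free[of y u v u' l] u u' uu' l y E_sym by blast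
    qed
    have "indep E {u, u', y}"
      unfolding indep_def using u u' uu' E_irrefl E_sym by blast
    then have "card {u, u', y} \<le> card {i, j}"
      using u u' notI inV i j Nu Nu' fy by (intro max_indep_exchange[OF I]) blast+
    moreover have "y \<noteq> u" "y \<noteq> u'"
      using u u' y by blast+
    ultimately show False
      using uu' \<open>i \<noteq> j\<close> by simp
  qed
  have "E w j \<or> E w' j"
    using chair_free[of w w' v y j] w w' y j nE ww'_y \<open>\<not> E v j\<close> \<open>w \<noteq> w'\<close> E_sym by blast
  then show False
    using larger[of w w'] larger[of w' w] w w' ww'_y inV notI \<open>w \<noteq> w'\<close> nE E_sym by blast
qed

end

subsection \<open>Graphs whose neighbourhoods are two disjoint cliques\<close>

text \<open>Models \<open>v\<close> as an edge of a triangle-free root graph, \<open>A\<close> and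
  \<open>B\<close> being the other edges at its two ends; nonemptiness means that neither end is a
  leaf.\<close>

definition (in fin_graph) two_cliq_nbhd :: "'a \<Rightarrow> 'a set \<Rightarrow> 'a set \<Rightarrow> bool" where
  "two_cliq_nbhd v A B \<longleftrightarrow> {u. E v u} = A \<union> B \<and> A \<noteq> {} \<and> B \<noteq> {} \<and> cliq E A \<and> cliq E B \<and>
     (\<forall>a\<in>A. \<forall>b\<in>B. a \<noteq> b \<and> \<not> E a b)"

lemma (in chair_gem_free) two_cliq_nbhd:
  assumes no_dom: "\<And>u x. E u x \<Longrightarrow> \<exists>z. E u z \<and> z \<noteq> x \<and> \<not> E x z"
    and no_hit: "\<And>Q. maximal_cliq Q \<Longrightarrow> \<exists>I. max_indep I \<and> Q \<inter> I = {}"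
    and "v \<in> V"
  shows "\<exists>A B. two_cliq_nbhd v A B"
proof -
  have "cliq E {v}" "{v} \<subseteq> V"
    using \<open>v \<in> V\<close> by (auto simp: cliq_def)
  then obtain Q where Q: "maximal_cliq Q" "{v} \<subseteq> Q"
    by (rule ex_maximal_cliq)
  obtain I where I: "max_indep I" "Q \<inter> I = {}"
    using no_hit[OF Q(1)] by blast
  have v: "missed I v"
    using Q I by (auto simp: missed_def)
  obtain i where i: "i \<in> I" "E v i"
    using max_indep_nbr[OF I(1), of v] Q(2) I(2) \<open>v \<in> V\<close> by blast
  note Iv = I(1) v i
  define A where "A = {u. E v u \<and> (u = i \<or> E u i)}"
  define B where "B = {u. E v u \<and> u \<noteq> i \<and> \<not> E u i}"
  have "cliq E A"
    unfolding cliq_def A_def using near_nbrs_adj[OF Iv] E_sym by blast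
  moreover have "cliq E B"
    unfolding cliq_def B_def using far_nbrs_adj[OF Iv] by blast
  moreover have "\<not> E a b" if a: "a \<in> A" and b: "b \<in> B" for a b
  proof
    assume ab: "E a b"
    have "E a i" "E v a"
      using a b ab E_sym unfolding A_def B_def by blast+
    \<comment> \<open>Non-domination supplies \<open>z\<close>, which must lie in the clique
      \<open>B\<close>; then \<open>v\<close> dominates the path i a b z, a gem.\<close>
    obtain z where z: "E v z" "z \<noteq> a" "\<not> E a z"
      using no_dom[OF \<open>E v a\<close>] by blast
    have "z \<in> A \<union> B"
      using z(1) by (auto simp: A_def B_def)
    then have "z \<in> B"
      using cliqD[OF \<open>cliq E A\<close> a, of z] z(2,3) by auto
    then have "E b z"
      using cliqD[OF \<open>cliq E B\<close> b, of z] z(3) ab by auto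
    moreover have "E v b" "\<not> E i b" "\<not> E i z"
      using b \<open>z \<in> B\<close> E_sym unfolding B_def by blast+
    ultimately show False
      using gem_free[of v i a b z] i(2) \<open>E v a\<close> E_sym[OF \<open>E a i\<close>] ab z by blast
  qed
  moreover have "i \<in> A"
    using i by (simp add: A_def)
  moreover have "B \<noteq> {}"
    using ex_missed_nbr[OF Iv] unfolding B_def by blast
  moreover have "{u. E v u} = A \<union> B" "A \<inter> B = {}"
    by (auto simp: A_def B_def)
  ultimately have "two_cliq_nbhd v A B"
    unfolding two_cliq_nbhd_def by blast
  then show ?thesis
    by blast
qed

section \<open>Counting a clique cover from the two-clique structure\<close>

context fin_graph
begin

lemma two_cliq_nbhd_sym: "two_cliq_nbhd v A B \<Longrightarrow> two_cliq_nbhd v B A"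
  unfolding two_cliq_nbhd_def by (metis E_sym Un_commute)

lemma finite_nbhd: "finite {u. E v u}"
proof (rule finite_subset[OF _ finite_V])
  show "{u. E v u} \<subseteq> V"
    using E_in_V[OF E_sym] by blast
qed

lemma two_cliq_nbhd_card:
  assumes "two_cliq_nbhd v A B"
  shows "finite A" "finite B" "card {u. E v u} = card A + card B" "card A \<ge> 1" "card B \<ge> 1"
proof -
  show fin: "finite A" "finite B"
    using assms finite_nbhd[of v] by (auto simp: two_cliq_nbhd_def)
  show "card {u. E v u} = card A + card B"
    using assms fin unfolding two_cliq_nbhd_def by (metis card_Un_disjoint disjoint_iff)
  show "card A \<ge> 1" "card B \<ge> 1"
    using assms fin by (auto simp: two_cliq_nbhd_def Suc_le_eq card_gt_0_iff)
qed

text \<open>One of the two cliques around \<open>u\<close> is the rest of \<open>insert v A\<close>: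
  for \<open>u\<close> in \<open>A\<close> it is the one containing \<open>v\<close>, as its members
  are adjacent to both \<open>u\<close> and \<open>v\<close> and so avoid \<open>B\<close>. What is
  left is the other clique.\<close>

lemma two_cliq_nbhd_other:
  assumes vAB: "two_cliq_nbhd v A B" and "u \<in> insert v A"
    and uPR: "u \<in> V \<Longrightarrow> \<exists>P R. two_cliq_nbhd u P R"
  shows "cliq E ({z. E u z} - insert v A)"
    and "z \<in> {z. E u z} - insert v A \<Longrightarrow> a \<in> insert v A - {u} \<Longrightarrow> \<not> E a z"
    and "{z. E u z} \<inter> insert v A = insert v A - {u}"
proof -
  have N: "E v x \<longleftrightarrow> x \<in> A \<or> x \<in> B" for x
    using vAB unfolding two_cliq_nbhd_def by blast
  have AB: "\<not> E a b" "a \<noteq> b" if "a \<in> A" "b \<in> B" for a b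
    using vAB that unfolding two_cliq_nbhd_def by blast+
  have "cliq E ({z. E u z} - insert v A) \<and>
      (\<forall>z\<in>{z. E u z} - insert v A. \<forall>a\<in>insert v A - {u}. \<not> E a z) \<and>
      {z. E u z} \<inter> insert v A = insert v A - {u}"
  proof (cases "u = v")
    case True
    moreover have "{z. E v z} - insert v A = B"
      using N AB E_irrefl by blast
    moreover have "cliq E B" "v \<notin> A" "{z. E v z} \<inter> insert v A = A"
      using vAB N E_irrefl unfolding two_cliq_nbhd_def by blast+
    ultimately show ?thesis
      using AB(1) by auto
  next
    case False
    then have u: "u \<in> A"
      using assms(2) by blast
    then have "E u v"
      using N E_sym by blast
    then obtain P R where "two_cliq_nbhd u P R" "v \<in> P \<union> R"
      using uPR[OF E_in_V[of u v]] unfolding two_cliq_nbhd_def by blast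
    then obtain P R where PR: "two_cliq_nbhd u P R" "v \<in> P"
      using two_cliq_nbhd_sym by blast
    have NP: "E u x \<longleftrightarrow> x \<in> P \<or> x \<in> R" for x
      using PR(1) unfolding two_cliq_nbhd_def by blast
    have PRn: "\<not> E a b" "a \<noteq> b" if "a \<in> P" "b \<in> R" for a b
      using PR(1) that unfolding two_cliq_nbhd_def by blast+
    have "P = insert v A - {u}"
    proof (intro set_eqI iffI)
      fix z assume z: "z \<in> P"
      then have "z = v \<or> E v z"
        using PR cliqD[of E P v z] unfolding two_cliq_nbhd_def by blast
      then show "z \<in> insert v A - {u}"
        using N NP z AB(1)[OF u] E_irrefl by blast
    next
      fix z assume z: "z \<in> insert v A - {u}"
      show "z \<in> P"
      proof (cases "z = v")
        case False
        then have "E u z" "E v z"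
          using z u N vAB cliqD[of E A u z] unfolding two_cliq_nbhd_def by blast+
        then show ?thesis
          using NP PRn(1)[OF PR(2), of z] by blast
      qed (use PR(2) in blast)
    qed
    moreover have "{z. E u z} - insert v A = R"
      using NP PRn(2) E_irrefl \<open>P = insert v A - {u}\<close> by blast
    moreover have "cliq E R" "{z. E u z} \<inter> insert v A = P"
      using PR(1) NP \<open>P = insert v A - {u}\<close> \<open>{z. E u z} - insert v A = R\<close>
      unfolding two_cliq_nbhd_def by blast+
    ultimately show ?thesis
      using PRn(1) by auto
  qed
  then show "cliq E ({z. E u z} - insert v A)"
    and "z \<in> {z. E u z} - insert v A \<Longrightarrow> a \<in> insert v A - {u} \<Longrightarrow> \<not> E a z"
    and "{z. E u z} \<inter> insert v A = insert v A - {u}"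
    by blast+
qed

text \<open>Let d be the minimum degree, so that |V| is at most D + 1 + d. A maximal matching with
  its unmatched vertices bounds twice the cover by D + 1 + d + w, which exceeds the target by d - 1;
  the cliques removed beforehand save this excess.\<close>

lemma clique_cover_two_cliq:
  assumes loc: "\<And>v. v \<in> V \<Longrightarrow> \<exists>A B. two_cliq_nbhd v A B"
    and D: "\<And>v. v \<in> V \<Longrightarrow> card {u \<in> V. u \<noteq> v \<and> \<not> E v u} \<le> D"
    and w: "\<And>J. J \<subseteq> V \<Longrightarrow> indep E J \<Longrightarrow> card J \<le> w"
  shows "clique_cover V E ((D + w + 2) div 2)"
proof (cases "V = {}")
  case False
  have sp: "symp E" "irreflp E"
    using E_sym E_irrefl by (auto simp: symp_def irreflp_def)
  obtain v where v: "v \<in> V" and vmin: "\<And>u. u \<in> V \<Longrightarrow> card {z. E v z} \<le> card {z. E u z}"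
    using False ex_has_least_nat[of "\<lambda>v. v \<in> V" _ "\<lambda>v. card {z. E v z}"] by blast
  obtain A B where AB: "two_cliq_nbhd v A B" and le: "card A \<le> card B"
    using loc[OF v] two_cliq_nbhd_sym by (metis nat_le_linear)
  note cAB = two_cliq_nbhd_card[OF AB]
  have N: "E v x \<longleftrightarrow> x \<in> A \<or> x \<in> B" for x
    using AB unfolding two_cliq_nbhd_def by blast
  have ABV: "A \<subseteq> V" "B \<subseteq> V"
    using N E_in_V E_sym by blast+
  have n: "card V \<le> D + 1 + card A + card B"
  proof -
    have "{u \<in> V. u \<noteq> v \<and> \<not> E v u} = V - insert v {u. E v u}"
      by blast
    moreover have "card (insert v {u. E v u}) = 1 + card A + card B"
      using finite_nbhd E_irrefl cAB(3) by (simp add: card_insert_if)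
    ultimately show ?thesis
      using D[OF v] diff_card_le_card_Diff[of "insert v {u. E v u}" V] finite_nbhd[of v] by simp
  qed
  have "\<exists>m. 2 * m \<le> D + w + 2 \<and> clique_cover V E m"
  proof (cases "card B = 1")
    case True
    then have "card A = 1"
      using le cAB by linarith
    then obtain y z where yz: "A = {y}" "B = {z}"
      using True by (auto simp: card_1_singleton_iff)
    have E: "E v y" "E v z" "\<not> E y z" "y \<noteq> z"
      using AB N yz by (auto simp: two_cliq_nbhd_def)
    obtain P R where PR: "two_cliq_nbhd z P R"
      using loc[of z] ABV yz by blast
    \<comment> \<open>Both cliques around \<open>z\<close> are nonempty and they are disjoint, so
      \<open>z\<close> has a second neighbour.\<close>
    obtain z' where z': "E z z'" "z' \<noteq> v"
      using PR unfolding two_cliq_nbhd_def by blast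
    have "z' \<noteq> y" "z' \<noteq> z" "v \<noteq> y" "v \<noteq> z"
      using z' E E_sym E_irrefl by blast+
    define S where "S = {v, y, z, z'}"
    have S: "card S = 4" "S \<subseteq> V"
      using \<open>z' \<noteq> y\<close> \<open>z' \<noteq> z\<close> \<open>v \<noteq> y\<close> \<open>v \<noteq> z\<close> z' E E_in_V E_sym[OF z'(1)] ABV yz v
      by (auto simp: S_def)
    \<comment> \<open>\<open>S\<close> contains the closed neighbourhood of \<open>v\<close>, so
      \<open>v\<close> extends every independent set outside \<open>S\<close>. This drop by one is
      exactly the excess d - 1 = 1.\<close>
    have "card J \<le> w - 1" if J: "J \<subseteq> V - S" "indep E J" for J
    proof -
      have "indep E (insert v J)"
        using J N yz E_sym E_irrefl unfolding indep_def S_def by blast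
      moreover have "finite J" "v \<notin> J"
        using J finite_V by (auto simp: S_def intro: finite_subset)
      ultimately show ?thesis
        using w[of "insert v J"] J v by force
    qed
    then obtain m where m: "2 * m \<le> card (V - S) + (w - 1)" "clique_cover (V - S) E m"
      using clique_cover_greedy_matching[of "V - S" E "w - 1"] finite_V sp by blast
    have "cliq E {v, y}" "cliq E {z, z'}"
      using E z' E_sym by (auto simp: cliq_def)
    then have "clique_cover ((V - S \<union> {v, y}) \<union> {z, z'}) E (Suc (Suc m))"
      using m by (intro clique_cover_Un_cliq)
    moreover have "(V - S \<union> {v, y}) \<union> {z, z'} = V"
      using S by (auto simp: S_def)
    moreover have "w \<ge> 1"
      using w[of "{v}"] v E_irrefl by (auto simp: indep_def)
    moreover have "card (V - S) = card V - 4" "card V \<ge> 4"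
      using S finite_V card_mono[of V S] by (auto simp: card_Diff_subset finite_subset)
    ultimately show ?thesis
      using m n True \<open>card A = 1\<close> by (intro exI[of _ "Suc (Suc m)"]) simp
  next
    case False
    then have B2: "card B \<ge> 2"
      using cAB by linarith
    let ?A = "insert v A"
    define Q where "Q u = insert u ({z. E u z} - ?A)" for u
    have AV: "?A \<subseteq> V" "finite ?A" "v \<notin> A"
      using v ABV cAB N E_irrefl by blast+
    note oth = two_cliq_nbhd_other[OF AB _ loc]
    have cl: "cliq E (Q u)" if "u \<in> ?A" for u
      unfolding cliq_def
    proof (intro ballI impI)
      fix x y assume "x \<in> Q u" "y \<in> Q u" "x \<noteq> y"
      then consider "x = u" "E u y" | "y = u" "E u x"
        | "x \<in> {z. E u z} - ?A" "y \<in> {z. E u z} - ?A"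
        unfolding Q_def by blast
      then show "E x y"
        using cliqD[OF oth(1)[OF that]] E_sym \<open>x \<noteq> y\<close> by cases blast+
    qed
    have QV: "Q u \<subseteq> V" if "u \<in> ?A" for u
      using that AV E_in_V E_sym unfolding Q_def by blast
    have disj: "Q u \<inter> Q u' = {}" if "u \<in> ?A" "u' \<in> ?A" "u \<noteq> u'" for u u'
      using oth(2)[OF that(1), of _ u'] that unfolding Q_def by blast
    \<comment> \<open>Just |A| neighbours of \<open>u\<close> lie in \<open>?A\<close>; by the
      minimal degree of \<open>v\<close>, at least |B| lie outside.\<close>
    have cQ: "card B + 1 \<le> card (Q u)" if "u \<in> ?A" for u
    proof -
      have "card ({z. E u z} \<inter> ?A) = card A"
        using oth(3)[OF that] that AV by simp
      then have "card ({z. E u z} - ?A) + card A = card {z. E u z}"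
        using card_Int_Diff[OF finite_nbhd[of u], of ?A] by simp
      then have "card B \<le> card ({z. E u z} - ?A)"
        using vmin[of u] that AV cAB(3) by auto
      then show ?thesis
        using finite_nbhd[of u] that unfolding Q_def by simp
    qed
    define U where "U = (\<Union>u\<in>?A. Q u)"
    have "U \<subseteq> V"
      using QV unfolding U_def by blast
    have "(card A + 1) * (card B + 1) = (\<Sum>u\<in>?A. card B + 1)"
      using AV by simp
    also have "\<dots> \<le> (\<Sum>u\<in>?A. card (Q u))"
      using cQ by (rule sum_mono)
    also have "\<dots> = card U"
      unfolding U_def using AV(2) disj QV finite_V
      by (intro card_UN_disjoint[symmetric]) (auto intro: finite_subset[OF QV])
    finally have cU: "(card A + 1) * (card B + 1) \<le> card U" .
    have "card J \<le> w" if "J \<subseteq> V - U" "indep E J" for J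
      using w that by blast
    then obtain m where m: "2 * m \<le> card (V - U) + w" "clique_cover (V - U) E m"
      using clique_cover_greedy_matching[of "V - U" E w] finite_V sp by blast
    have "clique_cover (V - U \<union> U) E (m + card ?A)"
      unfolding U_def using m(2) cl AV(2) by (intro clique_cover_UN_cliq) (auto simp: U_def)
    then have "clique_cover V E (m + card ?A)"
      using \<open>U \<subseteq> V\<close> by (simp add: Un_absorb2)
    moreover have "card V = card (V - U) + card U"
      using \<open>U \<subseteq> V\<close> finite_V by (metis card_Diff_subset card_mono finite_subset le_add_diff_inverse2)
    \<comment> \<open>\<open>p\<close> stands for the product |A| |B|, which keeps the final
      inequality linear; |B| at least 2 enters only through its lower bound.\<close>
    moreover obtain p where "2 * card A \<le> p" "p + card A + card B + 1 \<le> card U"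
    proof
      show "2 * card A \<le> card A * card B"
        using B2 by simp
      show "card A * card B + card A + card B + 1 \<le> card U"
        using cU by (simp add: algebra_simps)
    qed
    moreover have "card ?A = card A + 1"
      using AV by simp
    ultimately have "2 * (m + card ?A) \<le> D + w + 2"
      using m(1) n by presburger
    then show ?thesis
      using \<open>clique_cover V E (m + card ?A)\<close> by blast
  qed
  then show ?thesis
    using clique_cover_mono by (metis div_le_mono nonzero_mult_div_cancel_left zero_neq_numeral)
qed simp

text \<open>\<open>x\<close> can join the clique of \<open>u\<close>, since it is adjacent to
  \<open>u\<close> and to all other neighbours of \<open>u\<close>.\<close>

lemma clique_cover_dominated:
  assumes "clique_cover (V - {x}) E k" "E u x" "\<And>z. E u z \<Longrightarrow> z \<noteq> x \<Longrightarrow> E x z"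
  shows "clique_cover V E k"
proof -
  obtain c where c: "c ` (V - {x}) \<subseteq> {..<k}"
    "\<And>y z. y \<in> V - {x} \<Longrightarrow> z \<in> V - {x} \<Longrightarrow> y \<noteq> z \<Longrightarrow> c y = c z \<Longrightarrow> E y z"
    using assms(1) unfolding clique_cover_def by blast
  have u: "u \<in> V - {x}"
    using assms(2) E_in_V E_irrefl by blast
  have x: "E x z" if "z \<in> V - {x}" "c z = c u" for z
    using that assms(3)[of z] c(2)[OF u that(1)] E_sym[OF assms(2)] by (cases "z = u") auto
  show ?thesis
    unfolding clique_cover_def
  proof (intro exI conjI ballI impI)
    show "(c(x := c u)) ` V \<subseteq> {..<k}"
      using c(1) u by auto
    show "E y z" if yz: "y \<in> V" "z \<in> V" "y \<noteq> z" "(c(x := c u)) y = (c(x := c u)) z" for y z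
    proof -
      consider "y = x" "z \<in> V - {x}" "c z = c u" | "z = x" "y \<in> V - {x}" "c y = c u"
        | "y \<in> V - {x}" "z \<in> V - {x}" "c y = c z"
        using yz by (auto split: if_splits)
      then show ?thesis
        using yz(3) c(2) x E_sym by cases blast+
    qed
  qed
qed

end

subsection \<open>Chair-free and gem-free graphs\<close>

text \<open>Gives the induced subgraph on \<open>S\<close>; \<open>E\<close> itself may violate
  \<open>E_in_V\<close> on a smaller vertex set.\<close>

definition restrict_rel :: "'a set \<Rightarrow> ('a \<Rightarrow> 'a \<Rightarrow> bool) \<Rightarrow> 'a \<Rightarrow> 'a \<Rightarrow> bool" where
  "restrict_rel S E x y \<longleftrightarrow> x \<in> S \<and> y \<in> S \<and> E x y"

lemma indep_restrict_rel: "J \<subseteq> S \<Longrightarrow> indep (restrict_rel S E) J \<longleftrightarrow> indep E J"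
  unfolding indep_def restrict_rel_def by blast

lemma clique_cover_restrict_rel: "clique_cover S (restrict_rel S E) k \<longleftrightarrow> clique_cover S E k"
  unfolding clique_cover_def restrict_rel_def by blast

lemma (in chair_gem_free) chair_gem_free_restrict:
  assumes "S \<subseteq> V"
  shows "chair_gem_free S (restrict_rel S E)"
proof
  show "finite S"
    using assms finite_V finite_subset by blast
  show "restrict_rel S E x y \<Longrightarrow> x \<in> S" "restrict_rel S E x y \<Longrightarrow> restrict_rel S E y x"
    "\<not> restrict_rel S E x x" for x y
    using E_sym E_irrefl by (auto simp: restrict_rel_def)
  show "restrict_rel S E y p" if "x \<noteq> y" "restrict_rel S E c x" "restrict_rel S E c y"
    "restrict_rel S E c z" "restrict_rel S E z p" "\<not> restrict_rel S E x y"
    "\<not> restrict_rel S E x z" "\<not> restrict_rel S E y z" "\<not> restrict_rel S E c p"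
    "\<not> restrict_rel S E x p" for c x y z p
    using that chair_free[of x y c z p] by (simp add: restrict_rel_def)
  show "restrict_rel S E p s" if "restrict_rel S E c p" "restrict_rel S E c q"
    "restrict_rel S E c r" "restrict_rel S E c s" "restrict_rel S E p q" "restrict_rel S E q r"
    "restrict_rel S E r s" "\<not> restrict_rel S E p r" "\<not> restrict_rel S E q s" for c p q r s
    using that gem_free[of c p q r s] by (simp add: restrict_rel_def)
qed

text \<open>Strong induction on the number of vertices. \<open>D\<close> and \<open>w\<close> are
  bounds rather than exact values, so a subgraph can inherit them or take smaller ones. The number
  of cliques is the ceiling of (D + w + 1) / 2.\<close>

lemma chair_gem_free_clique_cover:
  assumes "chair_gem_free V E"
    and "\<And>v. v \<in> V \<Longrightarrow> card {u \<in> V. u \<noteq> v \<and> \<not> E v u} \<le> D"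
    and "\<And>J. J \<subseteq> V \<Longrightarrow> indep E J \<Longrightarrow> card J \<le> w"
  shows "clique_cover V E ((D + w + 2) div 2)"
  using assms
proof (induction "card V" arbitrary: V E D w rule: less_induct)
  case less
  note D = less.prems(2) and w = less.prems(3)
  interpret chair_gem_free V E
    by fact
  have IH: "clique_cover S E ((D' + w' + 2) div 2)"
    if "S \<subset> V" "\<And>v. v \<in> S \<Longrightarrow> card {u \<in> S. u \<noteq> v \<and> \<not> E v u} \<le> D'"
      "\<And>J. J \<subseteq> S \<Longrightarrow> indep E J \<Longrightarrow> card J \<le> w'" for S D' w'
  proof -
    have "clique_cover S (restrict_rel S E) ((D' + w' + 2) div 2)"
    proof (rule less.hyps)
      show "card S < card V"
        using that(1) finite_V by (simp add: psubset_card_mono)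
      show "chair_gem_free S (restrict_rel S E)"
        using chair_gem_free_restrict that(1) by blast
      show "card {u \<in> S. u \<noteq> v \<and> \<not> restrict_rel S E v u} \<le> D'" if "v \<in> S" for v
      proof -
        have "{u \<in> S. u \<noteq> v \<and> \<not> restrict_rel S E v u} = {u \<in> S. u \<noteq> v \<and> \<not> E v u}"
          using that by (auto simp: restrict_rel_def)
        then show ?thesis
          using \<open>\<And>v. v \<in> S \<Longrightarrow> card {u \<in> S. u \<noteq> v \<and> \<not> E v u} \<le> D'\<close>[OF that] by simp
      qed
      show "card J \<le> w'" if "J \<subseteq> S" "indep (restrict_rel S E) J" for J
        using that \<open>\<And>J. J \<subseteq> S \<Longrightarrow> indep E J \<Longrightarrow> card J \<le> w'\<close> indep_restrict_rel by blast
    qed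
    then show ?thesis
      by (simp add: clique_cover_restrict_rel)
  qed
  consider
    (dom) u x where "E u x" "\<And>z. E u z \<Longrightarrow> z \<noteq> x \<Longrightarrow> E x z"
    | (hit) Q where "maximal_cliq Q" "\<And>I. max_indep I \<Longrightarrow> Q \<inter> I \<noteq> {}"
    | (free) "\<And>u x. E u x \<Longrightarrow> \<exists>z. E u z \<and> z \<noteq> x \<and> \<not> E x z"
        "\<And>Q. maximal_cliq Q \<Longrightarrow> \<exists>I. max_indep I \<and> Q \<inter> I = {}"
    by blast
  then show ?case
  proof cases
    case dom
    have "clique_cover (V - {x}) E ((D + w + 2) div 2)"
    proof (rule IH)
      show "V - {x} \<subset> V"
        using E_in_V[OF E_sym[OF dom(1)]] by blast
      show "card {u \<in> V - {x}. u \<noteq> v \<and> \<not> E v u} \<le> D" if "v \<in> V - {x}" for v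
      proof -
        have "card {u \<in> V - {x}. u \<noteq> v \<and> \<not> E v u} \<le> card {u \<in> V. u \<noteq> v \<and> \<not> E v u}"
          using finite_V by (intro card_mono) auto
        then show ?thesis
          using D[of v] that by simp
      qed
      show "card J \<le> w" if "J \<subseteq> V - {x}" "indep E J" for J
        using that w by blast
    qed
    then show ?thesis
      using clique_cover_dominated dom by blast
  next
    case hit
    have Q: "Q \<subseteq> V" "cliq E Q" "\<And>z. z \<in> V - Q \<Longrightarrow> \<exists>q\<in>Q. \<not> E q z"
      using hit(1) by (auto simp: maximal_cliq_def)
    have VQ: "V - Q \<union> Q = V"
      using Q by blast
    show ?thesis
    proof (cases "V - Q = {}")
      case True
      then have "{} \<union> Q = V"
        using Q(1) by blast
      then have "clique_cover V E (Suc 0)"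
        using clique_cover_Un_cliq[OF clique_cover_empty Q(2)] by metis
      then show ?thesis
        by (rule clique_cover_mono) simp
    next
      case False
      have less: "card {u \<in> V - Q. u \<noteq> v \<and> \<not> E v u} < D" if v: "v \<in> V - Q" for v
      proof -
        obtain q where "q \<in> Q" "\<not> E q v"
          using Q(3)[OF v] by blast
        then have "q \<in> {u \<in> V. u \<noteq> v \<and> \<not> E v u} - {u \<in> V - Q. u \<noteq> v \<and> \<not> E v u}"
          using Q(1) v E_sym by blast
        then have "{u \<in> V - Q. u \<noteq> v \<and> \<not> E v u} \<subset> {u \<in> V. u \<noteq> v \<and> \<not> E v u}"
          by blast
        then have "card {u \<in> V - Q. u \<noteq> v \<and> \<not> E v u} < card {u \<in> V. u \<noteq> v \<and> \<not> E v u}"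
          using finite_V by (intro psubset_card_mono) auto
        then show ?thesis
          using D[of v] v by simp
      qed
      \<comment> \<open>An independent set of size \<open>w\<close> outside \<open>Q\<close> would
        be maximum and avoid \<open>Q\<close>.\<close>
      have wless: "card J < w" if "J \<subseteq> V - Q" "indep E J" for J
      proof (rule ccontr)
        assume "\<not> card J < w"
        then have "max_indep J"
          using that w unfolding max_indep_def by (meson Diff_subset not_less order_trans)
        then show False
          using hit(2) that(1) by blast
      qed
      \<comment> \<open>Keeps the natural-number subtractions exact: both bounds drop by one, which
        pays for \<open>Q\<close>.\<close>
      have "D \<ge> 1" "w \<ge> 1"
        using less wless[of "{}"] False by (force simp: indep_def)+
      have "Q \<noteq> {}"
        using False Q(3) by blast
      have "clique_cover (V - Q) E (((D - 1) + (w - 1) + 2) div 2)"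
      proof (rule IH)
        show "V - Q \<subset> V"
          using Q(1) \<open>Q \<noteq> {}\<close> by blast
        show "card {u \<in> V - Q. u \<noteq> v \<and> \<not> E v u} \<le> D - 1" if "v \<in> V - Q" for v
          using less[OF that] by linarith
        show "card J \<le> w - 1" if "J \<subseteq> V - Q" "indep E J" for J
          using wless[OF that] by linarith
      qed
      then have "clique_cover V E (Suc (((D - 1) + (w - 1) + 2) div 2))"
        using clique_cover_Un_cliq[OF _ Q(2)] VQ by metis
      then show ?thesis
        by (rule clique_cover_mono) (use \<open>D \<ge> 1\<close> \<open>w \<ge> 1\<close> in linarith)
    qed
  next
    case free
    show ?thesis
      using two_cliq_nbhd[OF free] D w by (rule clique_cover_two_cliq)
  qed
qed

subsection \<open>Complements of graphs without induced kite and \<open>P\<^sub>4 \<union> K\<^sub>1\<close>\<close>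

text \<open>The isomorphism runs from the induced subgraph to \<open>F\<close>, so it uses the
  inverse \<open>g\<close> of \<open>f\<close> and sends each arc to the pair of images of its ends;
  this is injective because there are no parallel arcs.\<close>

lemma contains_inducedI:
  fixes f :: "'c \<Rightarrow> 'a"
  assumes G: "graph G" and f: "inj_on f (pverts F)" "f ` pverts F \<subseteq> verts G"
    and F: "parcs F \<subseteq> pverts F \<times> pverts F"
    and iso: "\<And>x y. x \<in> pverts F \<Longrightarrow> y \<in> pverts F \<Longrightarrow> f x \<rightarrow>\<^bsub>G\<^esub> f y \<longleftrightarrow> (x, y) \<in> parcs F"
  shows "contains_induced G (with_proj F)"
proof -
  interpret graph G
    by fact
  let ?S = "f ` pverts F"
  define g where "g = the_inv_into (pverts F) f"
  have gf: "g (f x) = x" if "x \<in> pverts F" for x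
    using that f(1) by (simp add: g_def the_inv_into_f_f)
  define h where "h = \<lparr>iso_verts = g, iso_arcs = \<lambda>e. (g (tail G e), g (head G e)),
    iso_head = snd, iso_tail = fst\<rparr>"
  have g_inj: "inj_on g ?S"
    using gf by (auto simp: inj_on_def)
  have "inj_on (\<lambda>e. (g (tail G e), g (head G e))) (arcs (G \<restriction> ?S))"
  proof (rule inj_onI)
    fix d e
    assume de: "d \<in> arcs (G \<restriction> ?S)" "e \<in> arcs (G \<restriction> ?S)"
      "(g (tail G d), g (head G d)) = (g (tail G e), g (head G e))"
    then have "tail G d = tail G e" "head G d = head G e"
      using inj_onD[OF g_inj] by auto
    then show "d = e"
      using de no_multi_arcs[of d e] by (simp add: arc_to_ends_def)
  qed
  then have "pre_digraph.digraph_isomorphism (G \<restriction> ?S) h"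
    unfolding pre_digraph.digraph_isomorphism_def
    using g_inj wellformed_induce_subgraph by (simp add: h_def)
  moreover have "with_proj F = app_iso h (G \<restriction> ?S)"
  proof -
    have "(\<lambda>e. (g (tail G e), g (head G e))) ` {e \<in> arcs G. tail G e \<in> ?S \<and> head G e \<in> ?S} = parcs F"
    proof (intro set_eqI iffI)
      fix p assume "p \<in> (\<lambda>e. (g (tail G e), g (head G e))) ` {e \<in> arcs G. tail G e \<in> ?S \<and> head G e \<in> ?S}"
      then obtain e x y where e: "e \<in> arcs G" "tail G e = f x" "head G e = f y"
        "x \<in> pverts F" "y \<in> pverts F" "p = (g (f x), g (f y))"
        by auto
      moreover have "f x \<rightarrow>\<^bsub>G\<^esub> f y"
        using e by (intro dominatesI[of e]) (auto simp: arc_to_ends_def)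
      ultimately show "p \<in> parcs F"
        using iso gf by simp
    next
      fix p assume p: "p \<in> parcs F"
      then obtain x y where xy: "p = (x, y)" "x \<in> pverts F" "y \<in> pverts F"
        using F by auto
      then have "f x \<rightarrow>\<^bsub>G\<^esub> f y"
        using iso p by simp
      then obtain e where "e \<in> arcs G" "tail G e = f x" "head G e = f y"
        by (auto simp: arcs_ends_conv)
      then show "p \<in> (\<lambda>e. (g (tail G e), g (head G e))) ` {e \<in> arcs G. tail G e \<in> ?S \<and> head G e \<in> ?S}"
        using xy gf by (intro image_eqI[of _ _ e]) auto
    qed
    moreover have "g ` ?S = pverts F"
      using gf by (auto simp: image_image)
    ultimately show ?thesis
      by (simp add: app_iso_def h_def with_proj_def)
  qed
  ultimately show ?thesis
    unfolding contains_induced_def digraph_iso_def using f(2) by blast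
qed

definition co_adj :: "('a,'b) pre_digraph \<Rightarrow> 'a \<Rightarrow> 'a \<Rightarrow> bool" where
  "co_adj G u v \<longleftrightarrow> u \<in> verts G \<and> v \<in> verts G \<and> u \<noteq> v \<and> \<not> u \<rightarrow>\<^bsub>G\<^esub> v"

text \<open>The chair is the complement of the kite; the gem is that of \<open>P4_K1\<close>,
  because the path on four vertices is self-complementary.\<close>

lemma co_adj_chair_gem_free:
  assumes G: "graph G" and "\<not> contains_induced G P4_K1" "\<not> contains_induced G kite"
  shows "chair_gem_free (verts G) (co_adj G)"
proof
  interpret graph G
    by fact
  have sym: "co_adj G u v \<Longrightarrow> co_adj G v u" for u v
    using arcs_ends_symmetric[OF sym_arcs] unfolding co_adj_def by blast
  then have nsym: "\<not> co_adj G u v \<Longrightarrow> \<not> co_adj G v u" for u v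
    by blast
  have adj: "u \<rightarrow>\<^bsub>G\<^esub> v \<longleftrightarrow> u \<noteq> v \<and> \<not> co_adj G u v" if "u \<in> verts G" "v \<in> verts G" for u v
    using that adj_not_same by (auto simp: co_adj_def)
  have verts: "u \<in> verts G" "v \<in> verts G" "u \<noteq> v" if "co_adj G u v" for u v
    using that by (auto simp: co_adj_def)
  show "finite (verts G)"
    by simp
  show "co_adj G x y \<Longrightarrow> x \<in> verts G" "\<not> co_adj G x x" for x y
    by (auto simp: co_adj_def)
  show "co_adj G x y \<Longrightarrow> co_adj G y x" for x y
    by (rule sym)
  show "co_adj G y p" if chair: "x \<noteq> y" "co_adj G c x" "co_adj G c y" "co_adj G c z" "co_adj G z p"
    "\<not> co_adj G x y" "\<not> co_adj G x z" "\<not> co_adj G y z" "\<not> co_adj G c p" "\<not> co_adj G x p"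
  for c x y z p
  proof (rule ccontr)
    assume n: "\<not> co_adj G y p"
    note E = chair n chair(2-5)[THEN sym] chair(6-)[THEN nsym] n[THEN nsym]
    have V: "x \<in> verts G" "y \<in> verts G" "z \<in> verts G" "p \<in> verts G" "c \<in> verts G"
      using E verts by blast+
    have "x \<noteq> z" "y \<noteq> z" "x \<noteq> p" "y \<noteq> p" "c \<noteq> p"
      using E by blast+
    note ne = this E(1) verts(3)[OF chair(2)] verts(3)[OF chair(3)]
      verts(3)[OF chair(4)] verts(3)[OF chair(5)]
    have "contains_induced G kite"
      unfolding kite_def
    \<comment> \<open>In \<open>G\<close> the diamond is z, x, y, p with \<open>z\<close> and
      \<open>p\<close> not adjacent, and \<open>c\<close> hangs on \<open>p\<close>.\<close>
    proof (rule contains_inducedI[OF G, of "\<lambda>n. [z, x, y, p, c] ! n"], goal_cases)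
      case (4 i j)
      then show ?case
        by (simp, elim disjE) (simp_all add: adj V E ne ne[symmetric] symcl_def)
    qed (use V in \<open>simp_all add: ne ne[symmetric] symcl_def\<close>)
    then show False
      using assms by blast
  qed
  show "co_adj G p s" if gem: "co_adj G c p" "co_adj G c q" "co_adj G c r" "co_adj G c s"
    "co_adj G p q" "co_adj G q r" "co_adj G r s" "\<not> co_adj G p r" "\<not> co_adj G q s"
  for c p q r s
  proof (rule ccontr)
    assume n: "\<not> co_adj G p s"
    note E = gem n gem(1-7)[THEN sym] gem(8-)[THEN nsym] n[THEN nsym]
    have V: "p \<in> verts G" "q \<in> verts G" "r \<in> verts G" "s \<in> verts G" "c \<in> verts G"
      using E verts by blast+
    have "p \<noteq> r" "q \<noteq> s" "p \<noteq> s"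
      using E by blast+
    note ne = this verts(3)[OF gem(1)] verts(3)[OF gem(2)] verts(3)[OF gem(3)]
      verts(3)[OF gem(4)] verts(3)[OF gem(5)] verts(3)[OF gem(6)] verts(3)[OF gem(7)]
    have "contains_induced G P4_K1"
      unfolding P4_K1_def
    \<comment> \<open>The complement of the path p q r s is the path q s p r; \<open>c\<close> is
      isolated.\<close>
    proof (rule contains_inducedI[OF G, of "\<lambda>n. [q, s, p, r, c] ! n"], goal_cases)
      case (4 i j)
      then show ?case
        by (simp, elim disjE) (simp_all add: adj V E ne ne[symmetric] symcl_def)
    qed (use V in \<open>simp_all add: ne ne[symmetric] symcl_def\<close>)
    then show False
      using assms by blast
  qed
qed

section \<open>Degree, clique number and colourings read in the complement\<close>

lemma (in graph) card_non_co_adj: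
  assumes "v \<in> verts G"
  shows "card {u \<in> verts G. u \<noteq> v \<and> \<not> co_adj G v u} \<le> max_degree G"
proof -
  have "{u \<in> verts G. u \<noteq> v \<and> \<not> co_adj G v u} \<subseteq> head G ` out_arcs G v"
    using assms by (force simp: co_adj_def arcs_ends_conv)
  then have "card {u \<in> verts G. u \<noteq> v \<and> \<not> co_adj G v u} \<le> out_degree G v"
    unfolding out_degree_def by (meson card_image_le card_mono finite_imageI finite_out_arcs order_trans)
  also have "\<dots> \<le> max_degree G"
    unfolding max_degree_def using assms by (intro Max_ge) auto
  finally show ?thesis .
qed

lemma (in graph) card_indep_co_adj:
  assumes "J \<subseteq> verts G" "indep (co_adj G) J"
  shows "card J \<le> clique_number G"
proof -
  have "finite {card S |S. clique G S}"
    by (rule finite_subset[of _ "card ` Pow (verts G)"]) (auto simp: clique_def)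
  moreover have "clique G J"
    using assms by (auto simp: clique_def indep_def co_adj_def)
  ultimately show ?thesis
    unfolding clique_number_def by (intro Max_ge) auto
qed

lemma (in graph) proper_coloring_if_clique_cover:
  assumes "clique_cover (verts G) (co_adj G) k"
  shows "\<exists>c. proper_coloring G k c"
proof -
  obtain c where c: "c ` verts G \<subseteq> {..<k}"
    "\<And>x y. x \<in> verts G \<Longrightarrow> y \<in> verts G \<Longrightarrow> x \<noteq> y \<Longrightarrow> c x = c y \<Longrightarrow> co_adj G x y"
    using assms unfolding clique_cover_def by blast
  have "c u \<noteq> c v" if "u \<rightarrow>\<^bsub>G\<^esub> v" for u v
    using that c(2)[of u v] adj_in_verts[OF that] adj_not_same by (auto simp: co_adj_def)
  then show ?thesis
    using c(1) unfolding proper_coloring_def by blast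
qed

theorem theorem1:
  fixes G :: "('a, 'b) pre_digraph"
  assumes "graph G"
    and "\<not> contains_induced G P4_K1"
    and "\<not> contains_induced G kite"
  shows "int (chromatic_number G)
           \<le> \<lceil>(real (max_degree G) + real (clique_number G) + 1) / 2\<rceil>"
proof -
  interpret graph G
    by fact
  let ?k = "(max_degree G + clique_number G + 2) div 2"
  have "clique_cover (verts G) (co_adj G) ?k"
    by (rule chair_gem_free_clique_cover[OF co_adj_chair_gem_free[OF assms]])
      (use card_non_co_adj card_indep_co_adj in auto)
  then have "chromatic_number G \<le> ?k"
    unfolding chromatic_number_def by (intro Least_le proper_coloring_if_clique_cover)
  then have "2 * chromatic_number G \<le> max_degree G + clique_number G + 2"
    by linarith
  then have "2 * real (chromatic_number G) \<le> real (max_degree G) + real (clique_number G) + 2"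
    by linarith
  \<comment> \<open>With n = \<open>max_degree G + clique_number G\<close>, the chromatic number
    minus 1 is at most n / 2, hence below (n + 1) / 2, as \<open>le_ceiling_iff\<close>
    demands.\<close>
  then show ?thesis
    by (simp add: le_ceiling_iff)
qed

end
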